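(* Let $E$ and $F$ be metric spaces. Then the following statements hold: (a) Suppose that the set $\mathrm{Iso}((\mathrm{Lip}(E),\|\cdot\|_s),(\mathrm{Lip}(F),\|\cdot\|_s))$ is canonical. Then every weak-local isometry $T:(\mathrm{Lip}(E),\|\cdot\|_s)\to(\mathrm{Lip}(F),\|\cdot\|_s)$ can be written in the form $T(f)=\tau\,\psi(f)$ for all $f\in\mathrm{Lip}(E)$, where $\tau\in\mathrm{Lip}(F)$ is unimodular and $\psi:\mathrm{Lip}(E)\to\mathrm{Lip}(F)$ is an algebra homomorphism. (b) Suppose that the set $\mathrm{Iso}((\mathrm{Lip}(E),\|\cdot\|_L),(\mathrm{Lip}(F),\|\cdot\|_L))$ is canonical. Then every weak-local isometry $T:(\mathrm{Lip}(E),\|\cdot\|_L)\to(\mathrm{Lip}(F),\|\cdot\|_L)$ can be written in the form $T(f)=\tau\,\psi(f)$ for all $f\in\mathrm{Lip}(E)$, where $\tau\in\mathrm{Lip}(F)$ is unimodular and $\psi:\mathrm{Lip}(E)\to\mathrm{Lip}(F)$ is an algebra homomorphism.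
   Context: For a metric space $E$, $\mathrm{Lip}(E)$ is the space of all bounded Lipschitz functions $f:E\to\mathbb{C}$, with pointwise operations (including pointwise multiplication). Put $L(f)=\sup\{|f(x)-f(y)|/d(x,y): x,y\in E,\ x\ne y\}$, $\|f\|_L=\max\{L(f),\|f\|_\infty\}$ and $\|f\|_s=L(f)+\|f\|_\infty$; both are complete norms on $\mathrm{Lip}(E)$. A function $\tau$ is unimodular if $|\tau(s)|=1$ for every $s$ in its domain. For Banach spaces $X,Y$, $\mathrm{Iso}(X,Y)$ denotes the set of all surjective linear isometries from $X$ onto $Y$. When $\mathrm{Lip}(E)$ and $\mathrm{Lip}(F)$ are both equipped with the norm $\|\cdot\|_s$, or both equipped with the norm $\|\cdot\|_L$, an element $T$ of $\mathrm{Iso}(\mathrm{Lip}(E),\mathrm{Lip}(F))$ is canonical if there exist $\tau\in\mathbb{C}$ with $|\tau|=1$ and a surjective isometry $\varphi:F\to E$ with $T(f)(s)=\tau f(\varphi(s))$ for all $f\in\mathrm{Lip}(E)$, $s\in F$; the set $\mathrm{Iso}(\mathrm{Lip}(E),\mathrm{Lip}(F))$ is canonical if every one of its elements is canonical. A weak-local isometry $T:X\to Y$ between Banach spaces is a linear mapping such that for each $x\in X$ and $\phi\in Y^*$ there exists $T_{x,\phi}\in\mathrm{Iso}(X,Y)$, depending on $x$ and $\phi$, with $\phi(T(x))=\phi(T_{x,\phi}(x))$. *)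

theory Defs
  imports "HOL-Analysis.Analysis"
begin

text \<open>
  Complex-valued bounded Lipschitz functions on a metric space, with pointwise operations.
  The space carries two norms that are both needed, so they are plain functions on the type
  rather than an instance of a normed-space class.
\<close>

typedef (overloaded) ('a :: metric_space) lip =
  "{f :: 'a \<Rightarrow> complex. bounded (range f) \<and> (\<exists>C. C-lipschitz_on UNIV f)}"
  morphisms lip_apply Abs_lip
proof -
  have "(\<lambda>_. 0) \<in> {f :: 'a \<Rightarrow> complex. bounded (range f) \<and> (\<exists>C. C-lipschitz_on UNIV f)}"
    by (auto intro!: exI[of _ 0] lipschitz_on_constant)
  then show ?thesis by blast
qed

setup_lifting type_definition_lip

lemma lip_const:
  "bounded (range (\<lambda>_ :: 'a :: metric_space. c :: complex)) \<and> (\<exists>C. C-lipschitz_on UNIV (\<lambda>_ :: 'a. c))"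
  by (auto intro!: exI[of _ 0] lipschitz_on_constant)

lemma lip_add:
  fixes f g :: "'a :: metric_space \<Rightarrow> complex"
  assumes "bounded (range f) \<and> (\<exists>C. C-lipschitz_on UNIV f)"
    and "bounded (range g) \<and> (\<exists>C. C-lipschitz_on UNIV g)"
  shows "bounded (range (\<lambda>x. f x + g x)) \<and> (\<exists>C. C-lipschitz_on UNIV (\<lambda>x. f x + g x))"
  using assms by (auto intro: bounded_plus_comp lipschitz_on_add)

lemma lip_mult:
  fixes f g :: "'a :: metric_space \<Rightarrow> complex"
  assumes f: "bounded (range f) \<and> (\<exists>C. C-lipschitz_on UNIV f)"
    and g: "bounded (range g) \<and> (\<exists>C. C-lipschitz_on UNIV g)"
  shows "bounded (range (\<lambda>x. f x * g x)) \<and> (\<exists>C. C-lipschitz_on UNIV (\<lambda>x. f x * g x))"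
proof -
  obtain A B where A: "\<And>x. norm (f x) \<le> A" and B: "\<And>x. norm (g x) \<le> B"
    using f g by (auto simp: bounded_iff)
  obtain C D where C: "C-lipschitz_on UNIV f" and D: "D-lipschitz_on UNIV g"
    using f g by auto
  have nn: "0 \<le> A" "0 \<le> B" "0 \<le> C" "0 \<le> D"
    using A B C D by (meson norm_ge_zero order_trans lipschitz_on_nonneg)+
  have "norm (f x * g x) \<le> A * B" for x
    using A[of x] B[of x] nn by (simp add: norm_mult mult_mono)
  then have "bounded (range (\<lambda>x. f x * g x))"
    by (auto simp: bounded_iff)
  moreover have "(A * D + B * C)-lipschitz_on UNIV (\<lambda>x. f x * g x)"
  proof (rule lipschitz_onI)
    fix x y :: 'a
    have "f x * g x - f y * g y = f x * (g x - g y) + (f x - f y) * g y"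
      by (simp add: algebra_simps)
    then have "dist (f x * g x) (f y * g y) \<le> norm (f x) * dist (g x) (g y) + dist (f x) (f y) * norm (g y)"
      by (metis dist_norm norm_mult norm_triangle_ineq)
    also have "\<dots> \<le> A * (D * dist x y) + (C * dist x y) * B"
      using A[of x] B[of y] nn lipschitz_onD[OF C, of x y] lipschitz_onD[OF D, of x y]
      by (intro add_mono mult_mono) auto
    finally show "dist (f x * g x) (f y * g y) \<le> (A * D + B * C) * dist x y"
      by (simp add: algebra_simps)
  qed (use nn in auto)
  ultimately show ?thesis by blast
qed

instantiation lip :: (metric_space) comm_ring_1
begin

lift_definition zero_lip :: "'a lip" is "\<lambda>_. 0" by (rule lip_const)

lift_definition one_lip :: "'a lip" is "\<lambda>_. 1" by (rule lip_const)

lift_definition plus_lip :: "'a lip \<Rightarrow> 'a lip \<Rightarrow> 'a lip" is "\<lambda>f g x. f x + g x"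
  by (rule lip_add)

lift_definition uminus_lip :: "'a lip \<Rightarrow> 'a lip" is "\<lambda>f x. - f x"
  by (auto simp: bounded_iff lipschitz_on_minus)

lift_definition minus_lip :: "'a lip \<Rightarrow> 'a lip \<Rightarrow> 'a lip" is "\<lambda>f g x. f x - g x"
  by (auto intro: bounded_minus_comp lipschitz_on_diff)

lift_definition times_lip :: "'a lip \<Rightarrow> 'a lip \<Rightarrow> 'a lip" is "\<lambda>f g x. f x * g x"
  by (rule lip_mult)

instance
  by standard (transfer, force simp: algebra_simps fun_eq_iff)+

end

lift_definition scale_lip :: "complex \<Rightarrow> ('a :: metric_space) lip \<Rightarrow> 'a lip" is "\<lambda>c f x. c * f x"
  by (intro lip_mult lip_const)

interpretation lip: vector_space "scale_lip :: complex \<Rightarrow> ('a :: metric_space) lip \<Rightarrow> 'a lip"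
  by standard (transfer, simp add: algebra_simps)+

text \<open>
  Inserting \<open>0\<close> gives the supremum over the empty set (one-point space) the value \<open>0\<close>;
  it changes nothing otherwise, all quotients being nonnegative.
\<close>
definition lip_number :: "('a :: metric_space) lip \<Rightarrow> real" where
  "lip_number f =
     Sup (insert 0 {cmod (lip_apply f x - lip_apply f y) / dist x y | x y. x \<noteq> y})"

definition sup_norm :: "('a :: metric_space) lip \<Rightarrow> real" where
  "sup_norm f = (SUP x. cmod (lip_apply f x))"

definition norm_L :: "('a :: metric_space) lip \<Rightarrow> real" where
  "norm_L f = max (lip_number f) (sup_norm f)"

definition norm_s :: "('a :: metric_space) lip \<Rightarrow> real" where
  "norm_s f = lip_number f + sup_norm f"

text \<open>In the next definitions \<open>nX\<close> and \<open>nY\<close> are the norms on the domain and on the codomain.\<close>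

definition Iso ::
    "(('e :: metric_space) lip \<Rightarrow> real) \<Rightarrow> (('f :: metric_space) lip \<Rightarrow> real) \<Rightarrow> ('e lip \<Rightarrow> 'f lip) set" where
  "Iso nX nY = {T. Vector_Spaces.linear scale_lip scale_lip T \<and> (\<forall>f. nY (T f) = nX f) \<and> surj T}"

definition canonical_map :: "(('e :: metric_space) lip \<Rightarrow> ('f :: metric_space) lip) \<Rightarrow> bool" where
  "canonical_map T \<longleftrightarrow>
     (\<exists>(\<tau> :: complex) (\<phi> :: 'f \<Rightarrow> 'e).
        cmod \<tau> = 1 \<and> surj \<phi> \<and> (\<forall>s t. dist (\<phi> s) (\<phi> t) = dist s t) \<and>
        (\<forall>f s. lip_apply (T f) s = \<tau> * lip_apply f (\<phi> s)))"

definition canonical :: "(('e :: metric_space) lip \<Rightarrow> ('f :: metric_space) lip) set \<Rightarrow> bool" where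
  "canonical S \<longleftrightarrow> (\<forall>T\<in>S. canonical_map T)"

definition dual :: "(('f :: metric_space) lip \<Rightarrow> real) \<Rightarrow> ('f lip \<Rightarrow> complex) set" where
  "dual nY = {\<phi>. Vector_Spaces.linear scale_lip (*) \<phi> \<and> (\<exists>C. \<forall>g. cmod (\<phi> g) \<le> C * nY g)}"

definition weak_local_isometry ::
    "(('e :: metric_space) lip \<Rightarrow> real) \<Rightarrow> (('f :: metric_space) lip \<Rightarrow> real) \<Rightarrow> ('e lip \<Rightarrow> 'f lip) \<Rightarrow> bool" where
  "weak_local_isometry nX nY T \<longleftrightarrow>
     Vector_Spaces.linear scale_lip scale_lip T \<and>
     (\<forall>f. \<forall>\<phi>\<in>dual nY. \<exists>S\<in>Iso nX nY. \<phi> (T f) = \<phi> (S f))"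

definition algebra_hom :: "(('e :: metric_space) lip \<Rightarrow> ('f :: metric_space) lip) \<Rightarrow> bool" where
  "algebra_hom \<psi> \<longleftrightarrow>
     Vector_Spaces.linear scale_lip scale_lip \<psi> \<and> (\<forall>f g. \<psi> (f * g) = \<psi> f * \<psi> g)"

definition unimodular :: "('f :: metric_space) lip \<Rightarrow> bool" where
  "unimodular \<tau> \<longleftrightarrow> (\<forall>s. cmod (lip_apply \<tau> s) = 1)"

end

theory Submission
  imports Defs
begin

text \<open>
  Fix a point \<open>s\<close>. Since evaluation at \<open>s\<close> is in the dual, \<open>T f s = c * f x\<close> for some unimodular
  \<open>c\<close> and some point \<open>x\<close>, both depending on \<open>f\<close>. Hence \<open>G f = T f s / T 1 s\<close> is a linear functional
  with \<open>G 1 = 1\<close> whose kernel contains no nowhere vanishing function, and so \<open>G f\<close> is always a value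
  of \<open>f\<close>. This is the setting of the Gleason-Kahane-Zelazko theorem, but as the algebra is
  self-adjoint no entire functions are needed: for real \<open>f\<close>, \<open>a = G f\<close> and \<open>G (f * f)\<close> are real, and
  the real number \<open>G ((f - a)\<^sup>2 + \<i> (f - a)) = G (f * f) - a\<^sup>2\<close> is a value of \<open>(f - a)\<^sup>2 + \<i> (f - a)\<close>,
  which is real only where \<open>f = a\<close>. So \<open>G (f * f) = a\<^sup>2\<close>.
\<close>

declare one_lip.rep_eq [simp] plus_lip.rep_eq [simp]
  uminus_lip.rep_eq [simp] minus_lip.rep_eq [simp] times_lip.rep_eq [simp] scale_lip.rep_eq [simp]

lemma lip_eqI: "(\<And>x. lip_apply f x = lip_apply g x) \<Longrightarrow> f = g"
  by (simp add: lip_apply_inject [symmetric] fun_eq_iff)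

text \<open>Conjugation serves twice: it splits a function into real and imaginary parts, and it
  inverts a unimodular function inside the algebra.\<close>

lift_definition cnj_lip :: "('a :: metric_space) lip \<Rightarrow> 'a lip" is "\<lambda>f x. cnj (f x)"
  by (auto simp: bounded_iff lipschitz_on_def dist_norm simp flip: complex_cnj_diff)

declare cnj_lip.rep_eq [simp]

lemma linear_functional_mult:
  fixes G :: "('a :: metric_space) lip \<Rightarrow> complex"
  assumes lin: "Vector_Spaces.linear scale_lip (*) G"
    and one: "G 1 = 1"
    and ker: "\<And>f. G f = 0 \<Longrightarrow> \<exists>x. lip_apply f x = 0"
  shows "G (f * g) = G f * G g"
proof -
  interpret G: Vector_Spaces.linear scale_lip "(*)" G by (fact lin)
  note G_simps = G.add G.diff G.scale one
  \<comment> \<open>Subtracting the constant \<open>G f\<close> puts \<open>f\<close> into the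
    kernel, so the difference has a zero.\<close>
  have range: "\<exists>x. lip_apply f x = G f" for f
    using ker [of "f - scale_lip (G f) 1"] by (simp add: G_simps)
  have real: "G f \<in> \<real>" if "\<And>x. lip_apply f x \<in> \<real>" for f
    using range [of f] that by metis
  have square: "G (f * f) = G f * G f" if f: "\<And>x. lip_apply f x \<in> \<real>" for f
  proof -
    obtain a where a: "G f = of_real a"
      using real [OF f] by (auto elim: Reals_cases)
    obtain b where b: "G (f * f) = of_real b"
      using real [of "f * f"] f by (auto elim: Reals_cases)
    define u where "u = f - scale_lip (of_real a) 1"
    have "u * u = f * f - scale_lip (2 * of_real a) f + scale_lip (of_real (a * a)) 1"
      by (rule lip_eqI, simp add: u_def) (simp add: algebra_simps)
    then have "G (u * u) = of_real (b - a * a)"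
      by (simp add: G_simps a b)
    \<comment> \<open>\<open>G u = 0\<close>, so adding \<open>\<i> u\<close> does not change the
      value.\<close>
    then have "G (u * u + scale_lip \<i> u) = of_real (b - a * a)"
      by (simp add: u_def G_simps a)
    then obtain x where "lip_apply (u * u + scale_lip \<i> u) x = of_real (b - a * a)"
      using range by metis
    moreover obtain r where "lip_apply u x = of_real r"
      using f [of x] by (auto simp: u_def elim!: Reals_cases) (metis of_real_diff)
    \<comment> \<open>With \<open>r\<close> the real value of \<open>u\<close> at \<open>x\<close>,
      the equation reads \<open>r\<^sup>2 + \<i> r = b - a\<^sup>2\<close>; imaginary parts give
      \<open>r = 0\<close>, then real parts give the claim.\<close>
    ultimately have "b = a * a"
      by (auto simp: complex_eq_iff)
    then show ?thesis
      by (simp add: a b)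
  qed
  have real_mult: "G (f * g) = G f * G g"
    if f: "\<And>x. lip_apply f x \<in> \<real>" and g: "\<And>x. lip_apply g x \<in> \<real>" for f g
  proof -
    \<comment> \<open>Polarization: squares determine products.\<close>
    have "(f + g) * (f + g) = f * f + scale_lip 2 (f * g) + g * g"
      by (rule lip_eqI, simp) (simp add: algebra_simps)
    then have "G ((f + g) * (f + g)) = G (f * f) + 2 * G (f * g) + G (g * g)"
      by (simp add: G_simps)
    moreover have "G ((f + g) * (f + g)) = (G f + G g) * (G f + G g)"
      using square [of "f + g"] f g by (simp add: G_simps)
    ultimately show ?thesis
      using square [OF f] square [OF g] by (simp add: algebra_simps)
  qed
  have decompose: "\<exists>p q. f = p + scale_lip \<i> q \<and> (\<forall>x. lip_apply p x \<in> \<real>) \<and> (\<forall>x. lip_apply q x \<in> \<real>)"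
    for f :: "'a lip"
  proof (intro exI conjI allI)
    show "f = scale_lip (1 / 2) (f + cnj_lip f) + scale_lip \<i> (scale_lip (- \<i> / 2) (f - cnj_lip f))"
      by (rule lip_eqI, simp) (simp add: field_simps)
  qed (simp_all add: complex_is_Real_iff)
  obtain p q where f: "f = p + scale_lip \<i> q"
    and pq: "\<And>x. lip_apply p x \<in> \<real>" "\<And>x. lip_apply q x \<in> \<real>"
    using decompose by blast
  obtain r t where g: "g = r + scale_lip \<i> t"
    and rt: "\<And>x. lip_apply r x \<in> \<real>" "\<And>x. lip_apply t x \<in> \<real>"
    using decompose by blast
  have "f * g = p * r - q * t + scale_lip \<i> (p * t + q * r)"
    unfolding f g by (rule lip_eqI, simp) (simp add: algebra_simps)
  then have "G (f * g) = G p * G r - G q * G t + \<i> * (G p * G t + G q * G r)"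
    by (simp add: G_simps real_mult pq rt)
  also have "\<dots> = G f * G g"
    by (simp add: f g G_simps algebra_simps)
  finally show ?thesis .
qed

lemma cmod_le_sup_norm: "cmod (lip_apply f x) \<le> sup_norm f"
proof -
  have "bounded (range (lip_apply f))"
    using lip_apply by blast
  then have "bdd_above (range (\<lambda>x. cmod (lip_apply f x)))"
    by (auto simp: bounded_iff bdd_above_def)
  then show ?thesis
    unfolding sup_norm_def by (rule cSUP_upper2) auto
qed

lemma lip_number_nonneg: "0 \<le> lip_number f"
proof -
  obtain C where C: "C-lipschitz_on UNIV (lip_apply f)"
    using lip_apply by blast
  \<comment> \<open>A Lipschitz constant bounds the quotients, so the supremum is a genuine upper
    bound of the inserted \<open>0\<close>.\<close>
  have "cmod (lip_apply f x - lip_apply f y) / dist x y \<le> C" if "x \<noteq> y" for x y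
    using lipschitz_onD [OF C, of x y] that by (simp add: dist_norm divide_le_eq)
  moreover have "0 \<le> C"
    using C by (rule lipschitz_on_nonneg)
  ultimately show ?thesis
    unfolding lip_number_def by (intro cSup_upper) (auto simp: bdd_above_def)
qed

lemma evaluation_in_dual:
  assumes "\<And>g. sup_norm g \<le> nY g"
  shows "(\<lambda>g. lip_apply g s) \<in> dual nY"
proof -
  have "Vector_Spaces.linear scale_lip (*) (\<lambda>g. lip_apply g s)"
    by (unfold_locales) (simp_all add: algebra_simps)
  moreover have "cmod (lip_apply g s) \<le> 1 * nY g" for g
    using cmod_le_sup_norm [of g s] assms [of g] by simp
  ultimately show ?thesis
    unfolding dual_def by blast
qed

text \<open>Stated for any \<open>nY\<close> dominating the sup norm, which makes evaluations
  continuous and covers both norms at once.\<close>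

lemma weak_local_isometry_representation:
  fixes T :: "('e :: metric_space) lip \<Rightarrow> ('f :: metric_space) lip"
  assumes nY: "\<And>g. sup_norm g \<le> nY g"
    and can: "canonical (Iso nX nY :: ('e lip \<Rightarrow> 'f lip) set)"
    and T: "weak_local_isometry nX nY T"
  shows "\<exists>\<tau> \<psi>. unimodular \<tau> \<and> algebra_hom \<psi> \<and> (\<forall>f. T f = \<tau> * \<psi> f)"
proof -
  have lin: "Vector_Spaces.linear scale_lip scale_lip T"
    using T by (simp add: weak_local_isometry_def)
  interpret T: Vector_Spaces.linear scale_lip scale_lip T by (fact lin)
  have attained: "\<exists>c x. cmod c = 1 \<and> lip_apply (T f) s = c * lip_apply f x" for f s
  proof -
    have "\<forall>\<phi>\<in>dual nY. \<exists>S\<in>Iso nX nY. \<phi> (T f) = \<phi> (S f)"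
      using T by (simp add: weak_local_isometry_def)
    from bspec [OF this evaluation_in_dual [OF nY]]
    obtain S where S: "S \<in> Iso nX nY" "lip_apply (T f) s = lip_apply (S f) s"
      by blast
    then have "canonical_map S"
      using can by (simp add: canonical_def)
    then show ?thesis
      using S(2) unfolding canonical_map_def by metis
  qed
  have norm_T1: "cmod (lip_apply (T 1) s) = 1" for s
    using attained [of 1 s] by auto
  then have cnj_T1: "lip_apply (T 1) s * cnj (lip_apply (T 1) s) = 1" for s
    by (simp add: complex_norm_square [symmetric])
  \<comment> \<open>As \<open>T 1\<close> is unimodular, its conjugate is its inverse, so this is
    the quotient of \<open>T f\<close> by \<open>T 1\<close>.\<close>
  define \<psi> where "\<psi> f = cnj_lip (T 1) * T f" for f
  have lin_\<psi>: "Vector_Spaces.linear scale_lip scale_lip \<psi>"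
    by unfold_locales (auto intro!: lip_eqI simp: \<psi>_def T.add T.scale algebra_simps)
  have "lip_apply (\<psi> (f * g)) s = lip_apply (\<psi> f) s * lip_apply (\<psi> g) s" for f g s
  proof (rule linear_functional_mult)
    interpret \<psi>: Vector_Spaces.linear scale_lip scale_lip \<psi> by (fact lin_\<psi>)
    show "Vector_Spaces.linear scale_lip (*) (\<lambda>f. lip_apply (\<psi> f) s)"
      by unfold_locales (simp_all add: \<psi>.add \<psi>.scale algebra_simps)
    show "lip_apply (\<psi> 1) s = 1"
      using cnj_T1 [of s] by (simp add: \<psi>_def mult.commute)
    \<comment> \<open>The unimodular factors cannot vanish, so the zero must come from
      \<open>f\<close> at the point given by \<open>attained\<close>.\<close>
    show "\<exists>x. lip_apply f x = 0" if "lip_apply (\<psi> f) s = 0" for f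
      using that norm_T1 [of s] attained [of f s] by (auto simp: \<psi>_def)
  qed
  then have "algebra_hom \<psi>"
    using lin_\<psi> by (auto simp: algebra_hom_def intro: lip_eqI)
  moreover have "unimodular (T 1)"
    by (simp add: unimodular_def norm_T1)
  moreover have "T f = T 1 * \<psi> f" for f
    by (rule lip_eqI) (simp add: \<psi>_def cnj_T1 flip: mult.assoc)
  ultimately show ?thesis
    by blast
qed

theorem theorem2p5:
  shows
    "(canonical (Iso norm_s norm_s :: (('e :: metric_space) lip \<Rightarrow> ('f :: metric_space) lip) set) \<longrightarrow>
       (\<forall>T :: 'e lip \<Rightarrow> 'f lip. weak_local_isometry norm_s norm_s T \<longrightarrow>
          (\<exists>\<tau> \<psi>. unimodular \<tau> \<and> algebra_hom \<psi> \<and> (\<forall>f. T f = \<tau> * \<psi> f)))) \<and>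
     (canonical (Iso norm_L norm_L :: ('e lip \<Rightarrow> 'f lip) set) \<longrightarrow>
       (\<forall>T :: 'e lip \<Rightarrow> 'f lip. weak_local_isometry norm_L norm_L T \<longrightarrow>
          (\<exists>\<tau> \<psi>. unimodular \<tau> \<and> algebra_hom \<psi> \<and> (\<forall>f. T f = \<tau> * \<psi> f))))"
  using weak_local_isometry_representation [of norm_s norm_s]
    weak_local_isometry_representation [of norm_L norm_L] lip_number_nonneg
  by (auto simp: norm_s_def norm_L_def)

end
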